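(* Let $\Gamma=(V,T,\mathbf{s},\mathbf{r})$ be a network. Then the semigroup $S_\Gamma$ is a right ample semigroup with a zero element.
   Context: A network $\Gamma=(V,T,\mathbf{s},\mathbf{r})$ consists of a set $V$ of vertices, a set $T$ of relations, and maps $\mathbf{s},\mathbf{r}:T\to\mathcal{P}(V)$ such that for every $t\in T$ the sets $\mathbf{s}(t)$ and $\mathbf{r}(t)$ are disjoint non-empty subsets of $V$; $V$ and $T$ are finite or countably infinite. A vertex $v$ is identified with the singleton $\{v\}$. Put $T^0=\{A\subseteq V: A=\mathbf{s}(t)\text{ or }A=\mathbf{r}(t)\text{ for some }t\in T\}\cup V$, and set $\mathbf{s}(A)=A=\mathbf{r}(A)$ for $A\in T^0$. For each $t\in T$ let $t^{-1}$ be a formal symbol with $\mathbf{s}(t^{-1})=\mathbf{r}(t)$, $\mathbf{r}(t^{-1})=\mathbf{s}(t)$; put $A^{-1}=A$ for $A\in T^0$ and $T^{-1}=\{t^{-1}:t\in T\}$. The symbol sets $T$, $T^0$, $T^{-1}$, $\{0\}$ are pairwise disjoint. $Q_\Gamma$ is the semigroup generated by $X=T\cup T^0\cup T^{-1}\cup\{0\}$ subject to the relations: (NR1) $\mathbf{s}(t)t=t=t\mathbf{r}(t)$ for $t\in T\cup T^0\cup T^{-1}$; (NR2) $t_1t_2=0$ if $\mathbf{r}(t_1)\cap\mathbf{s}(t_2)=\emptyset$, for $t_1,t_2\in T\cup T^0\cup T^{-1}$; (NR3) $t_1^{-1}t_2=0$ if $t_1\neq t_2$, for $t_1,t_2\in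 T$; (NR4) $t^{-1}t=\mathbf{r}(t)$ for $t\in T$; (NR5) $t^{-1}A=0$ if $\mathbf{s}(t)\neq A$, for $t\in T$, $A\in T^0$; (NR6) $0x=0=x0$ for all $x\in X$. $[w]$ denotes the class in $Q_\Gamma$ of a word $w$. A non-zero path is a finite non-empty sequence $\alpha=t_1\cdots t_n$ with $t_i\in T\cup T^0$ and $\mathbf{r}(t_i)\cap\mathbf{s}(t_{i+1})\neq\emptyset$ for $1\le i<n$; $\mathbf{s}(\alpha)=\mathbf{s}(t_1)$, $\mathbf{r}(\alpha)=\mathbf{r}(t_n)$, $\alpha^{-1}=t_n^{-1}\cdots t_1^{-1}$. It is linear if $\mathbf{r}(t_i)=\mathbf{s}(t_{i+1})$ for $1\le i<n$, and reduced if $t_i\neq\mathbf{s}(t_{i+1})$ and $t_{i+1}\neq\mathbf{r}(t_i)$ for $1\le i<n$. $RP(\Gamma)$ is the set of reduced paths (together with $0$) and $RLP(\Gamma)$ the set of non-zero reduced linear paths. $S_\Gamma=\{[\alpha\beta^{-1}]\in Q_\Gamma:\alpha\in RP(\Gamma)\setminus\{0\},\ \beta\in RLP(\Gamma)\setminus T^0,\ \mathbf{r}(\alpha)=\mathbf{r}(\beta)\}\cup\{[0]\}$, a subsemigroup of $Q_\Gamma$. For $a,b$ in a semigroup $S$, $a\,\mathcal{L}^*\,b$ means: for all $x,y\in S^1$, $ax=ay\Leftrightarrow bx=by$. A semigroup $S$ is right ample if each $\mathcal{L}^*$-class contains an idempotent, idempotents commute, and $ea=a(ea)^*$ for all $a\in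 S$ and all idempotents $e$, where $b^*$ denotes the (then unique) idempotent in the $\mathcal{L}^*$-class of $b$. *)

theory Defs
  imports Main "HOL-Library.Countable_Set"
begin

section \<open>Right ample semigroups\<close>

locale semigroup_on =
  fixes S :: "'a set" and mul :: "'a \<Rightarrow> 'a \<Rightarrow> 'a"
  assumes closed: "x \<in> S \<Longrightarrow> y \<in> S \<Longrightarrow> mul x y \<in> S"
    and assoc: "x \<in> S \<Longrightarrow> y \<in> S \<Longrightarrow> z \<in> S \<Longrightarrow> mul (mul x y) z = mul x (mul y z)"

definition is_zero :: "'a set \<Rightarrow> ('a \<Rightarrow> 'a \<Rightarrow> 'a) \<Rightarrow> 'a \<Rightarrow> bool" where
  "is_zero S mul z \<longleftrightarrow> z \<in> S \<and> (\<forall>x\<in>S. mul z x = z \<and> mul x z = z)"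

definition has_identity :: "'a set \<Rightarrow> ('a \<Rightarrow> 'a \<Rightarrow> 'a) \<Rightarrow> bool" where
  "has_identity S mul \<longleftrightarrow> (\<exists>e\<in>S. \<forall>x\<in>S. mul e x = x \<and> mul x e = x)"

text \<open>S with an identity adjoined if it has none; \<^const>\<open>None\<close> is the adjoined identity.\<close>

definition adjoin_one :: "'a set \<Rightarrow> ('a \<Rightarrow> 'a \<Rightarrow> 'a) \<Rightarrow> 'a option set" where
  "adjoin_one S mul = (if has_identity S mul then Some ` S else insert None (Some ` S))"

fun mul_one :: "('a \<Rightarrow> 'a \<Rightarrow> 'a) \<Rightarrow> 'a option \<Rightarrow> 'a option \<Rightarrow> 'a option" where
  "mul_one mul (Some a) (Some b) = Some (mul a b)"
| "mul_one mul None y = y"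
| "mul_one mul x None = x"

definition Lstar :: "'a set \<Rightarrow> ('a \<Rightarrow> 'a \<Rightarrow> 'a) \<Rightarrow> 'a \<Rightarrow> 'a \<Rightarrow> bool" where
  "Lstar S mul a b \<longleftrightarrow>
     (\<forall>x\<in>adjoin_one S mul. \<forall>y\<in>adjoin_one S mul.
        mul_one mul (Some a) x = mul_one mul (Some a) y \<longleftrightarrow>
        mul_one mul (Some b) x = mul_one mul (Some b) y)"

definition idempotents :: "'a set \<Rightarrow> ('a \<Rightarrow> 'a \<Rightarrow> 'a) \<Rightarrow> 'a set" where
  "idempotents S mul = {e \<in> S. mul e e = e}"

text \<open>The element \<open>b\<^sup>*\<close>; well defined when the class of \<open>b\<close> contains an idempotent and
  idempotents commute.\<close>

definition star :: "'a set \<Rightarrow> ('a \<Rightarrow> 'a \<Rightarrow> 'a) \<Rightarrow> 'a \<Rightarrow> 'a" where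
  "star S mul b = (THE e. e \<in> idempotents S mul \<and> Lstar S mul b e)"

locale right_ample = semigroup_on +
  assumes Lstar_idempotent: "a \<in> S \<Longrightarrow> \<exists>e\<in>idempotents S mul. Lstar S mul a e"
    and idempotents_commute:
      "e \<in> idempotents S mul \<Longrightarrow> f \<in> idempotents S mul \<Longrightarrow> mul e f = mul f e"
    and ample: "a \<in> S \<Longrightarrow> e \<in> idempotents S mul \<Longrightarrow> mul e a = mul a (star S mul (mul e a))"


section \<open>Networks\<close>

record ('v, 't) net =
  verts :: "'v set"
  rels :: "'t set"
  nsrc :: "'t \<Rightarrow> 'v set"
  nrng :: "'t \<Rightarrow> 'v set"

locale network =
  fixes \<Gamma> :: "('v, 't) net"
  assumes countable_verts: "countable (verts \<Gamma>)"
    and countable_rels: "countable (rels \<Gamma>)"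
    and src_subset: "t \<in> rels \<Gamma> \<Longrightarrow> nsrc \<Gamma> t \<subseteq> verts \<Gamma>"
    and rng_subset: "t \<in> rels \<Gamma> \<Longrightarrow> nrng \<Gamma> t \<subseteq> verts \<Gamma>"
    and src_nonempty: "t \<in> rels \<Gamma> \<Longrightarrow> nsrc \<Gamma> t \<noteq> {}"
    and rng_nonempty: "t \<in> rels \<Gamma> \<Longrightarrow> nrng \<Gamma> t \<noteq> {}"
    and src_rng_disjoint: "t \<in> rels \<Gamma> \<Longrightarrow> nsrc \<Gamma> t \<inter> nrng \<Gamma> t = {}"

text \<open>A vertex \<open>v\<close> is identified with \<open>{v}\<close>.\<close>

definition T0 :: "('v, 't) net \<Rightarrow> 'v set set" where
  "T0 \<Gamma> = nsrc \<Gamma> ` rels \<Gamma> \<union> nrng \<Gamma> ` rels \<Gamma> \<union> (\<lambda>v. {v}) ` verts \<Gamma>"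

datatype ('v, 't) symb = Rel 't | VSet "'v set" | Inv 't | Zero

definition T_symbs :: "('v, 't) net \<Rightarrow> ('v, 't) symb set" where
  "T_symbs \<Gamma> = Rel ` rels \<Gamma>"

definition T0_symbs :: "('v, 't) net \<Rightarrow> ('v, 't) symb set" where
  "T0_symbs \<Gamma> = VSet ` T0 \<Gamma>"

definition Tinv_symbs :: "('v, 't) net \<Rightarrow> ('v, 't) symb set" where
  "Tinv_symbs \<Gamma> = Inv ` rels \<Gamma>"

definition nz_symbs :: "('v, 't) net \<Rightarrow> ('v, 't) symb set" where
  "nz_symbs \<Gamma> = T_symbs \<Gamma> \<union> T0_symbs \<Gamma> \<union> Tinv_symbs \<Gamma>"

definition symbs :: "('v, 't) net \<Rightarrow> ('v, 't) symb set" where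
  "symbs \<Gamma> = nz_symbs \<Gamma> \<union> {Zero}"

text \<open>\<^const>\<open>Zero\<close> has no source or range; the values given to it here are never used.\<close>

primrec src :: "('v, 't) net \<Rightarrow> ('v, 't) symb \<Rightarrow> 'v set" where
  "src \<Gamma> (Rel t) = nsrc \<Gamma> t"
| "src \<Gamma> (VSet A) = A"
| "src \<Gamma> (Inv t) = nrng \<Gamma> t"
| "src \<Gamma> Zero = {}"

primrec rng :: "('v, 't) net \<Rightarrow> ('v, 't) symb \<Rightarrow> 'v set" where
  "rng \<Gamma> (Rel t) = nrng \<Gamma> t"
| "rng \<Gamma> (VSet A) = A"
| "rng \<Gamma> (Inv t) = nsrc \<Gamma> t"
| "rng \<Gamma> Zero = {}"

primrec symb_inv :: "('v, 't) symb \<Rightarrow> ('v, 't) symb" where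
  "symb_inv (Rel t) = Inv t"
| "symb_inv (VSet A) = VSet A"
| "symb_inv (Inv t) = Rel t"
| "symb_inv Zero = Zero"


section \<open>The semigroup presented by a network\<close>

text \<open>The free semigroup on the symbols: non-empty words under concatenation.\<close>

definition word_set :: "('v, 't) net \<Rightarrow> ('v, 't) symb list set" where
  "word_set \<Gamma> = {w. w \<noteq> [] \<and> set w \<subseteq> symbs \<Gamma>}"

inductive NR :: "('v, 't) net \<Rightarrow> ('v, 't) symb list \<Rightarrow> ('v, 't) symb list \<Rightarrow> bool"
  for \<Gamma> :: "('v, 't) net" where
  NR1_src: "x \<in> nz_symbs \<Gamma> \<Longrightarrow> NR \<Gamma> [VSet (src \<Gamma> x), x] [x]"
| NR1_rng: "x \<in> nz_symbs \<Gamma> \<Longrightarrow> NR \<Gamma> [x, VSet (rng \<Gamma> x)] [x]"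
| NR2: "x \<in> nz_symbs \<Gamma> \<Longrightarrow> y \<in> nz_symbs \<Gamma> \<Longrightarrow> rng \<Gamma> x \<inter> src \<Gamma> y = {} \<Longrightarrow> NR \<Gamma> [x, y] [Zero]"
| NR3: "t \<in> rels \<Gamma> \<Longrightarrow> u \<in> rels \<Gamma> \<Longrightarrow> t \<noteq> u \<Longrightarrow> NR \<Gamma> [Inv t, Rel u] [Zero]"
| NR4: "t \<in> rels \<Gamma> \<Longrightarrow> NR \<Gamma> [Inv t, Rel t] [VSet (nrng \<Gamma> t)]"
| NR5: "t \<in> rels \<Gamma> \<Longrightarrow> A \<in> T0 \<Gamma> \<Longrightarrow> nsrc \<Gamma> t \<noteq> A \<Longrightarrow> NR \<Gamma> [Inv t, VSet A] [Zero]"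
| NR6_left: "x \<in> symbs \<Gamma> \<Longrightarrow> NR \<Gamma> [Zero, x] [Zero]"
| NR6_right: "x \<in> symbs \<Gamma> \<Longrightarrow> NR \<Gamma> [x, Zero] [Zero]"

text \<open>The least congruence on the free semigroup that contains the defining relations.\<close>

inductive ncong :: "('v, 't) net \<Rightarrow> ('v, 't) symb list \<Rightarrow> ('v, 't) symb list \<Rightarrow> bool"
  for \<Gamma> :: "('v, 't) net" where
  base: "NR \<Gamma> u v \<Longrightarrow> u \<in> word_set \<Gamma> \<Longrightarrow> v \<in> word_set \<Gamma> \<Longrightarrow> ncong \<Gamma> u v"
| refl: "u \<in> word_set \<Gamma> \<Longrightarrow> ncong \<Gamma> u u"
| sym: "ncong \<Gamma> u v \<Longrightarrow> ncong \<Gamma> v u"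
| trans: "ncong \<Gamma> u v \<Longrightarrow> ncong \<Gamma> v w \<Longrightarrow> ncong \<Gamma> u w"
| mult: "ncong \<Gamma> u v \<Longrightarrow> ncong \<Gamma> u' v' \<Longrightarrow> ncong \<Gamma> (u @ u') (v @ v')"

definition ncong_rel :: "('v, 't) net \<Rightarrow> ('v, 't) symb list rel" where
  "ncong_rel \<Gamma> = {(u, v). ncong \<Gamma> u v}"

definition wclass :: "('v, 't) net \<Rightarrow> ('v, 't) symb list \<Rightarrow> ('v, 't) symb list set" where
  "wclass \<Gamma> w = ncong_rel \<Gamma> `` {w}"

definition Q :: "('v, 't) net \<Rightarrow> ('v, 't) symb list set set" where
  "Q \<Gamma> = word_set \<Gamma> // ncong_rel \<Gamma>"

text \<open>The product of two classes is the class of the concatenations of their words.\<close>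

definition qmul ::
  "('v, 't) net \<Rightarrow> ('v, 't) symb list set \<Rightarrow> ('v, 't) symb list set \<Rightarrow> ('v, 't) symb list set" where
  "qmul \<Gamma> C D = ncong_rel \<Gamma> `` {u @ v |u v. u \<in> C \<and> v \<in> D}"

lemma ncong_words: "ncong \<Gamma> u v \<Longrightarrow> u \<in> word_set \<Gamma> \<and> v \<in> word_set \<Gamma>"
  by (induction rule: ncong.induct) (auto simp: word_set_def)

lemma equiv_ncong_rel: "equiv (word_set \<Gamma>) (ncong_rel \<Gamma>)"
  by (rule equivI)
    (auto simp: ncong_rel_def refl_on_def sym_def trans_def
      dest: ncong_words intro: ncong.refl ncong.sym ncong.trans)

lemma qmul_wclass:
  assumes "u \<in> word_set \<Gamma>" "v \<in> word_set \<Gamma>"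
  shows "qmul \<Gamma> (wclass \<Gamma> u) (wclass \<Gamma> v) = wclass \<Gamma> (u @ v)"
  using assms
  by (auto simp: qmul_def wclass_def ncong_rel_def
      intro: ncong.trans ncong.mult ncong.refl)

lemma append_in_word_set: "u \<in> word_set \<Gamma> \<Longrightarrow> v \<in> word_set \<Gamma> \<Longrightarrow> u @ v \<in> word_set \<Gamma>"
  by (auto simp: word_set_def)

lemma Q_eq: "Q \<Gamma> = wclass \<Gamma> ` word_set \<Gamma>"
  by (auto simp: Q_def quotient_def wclass_def)

lemma semigroup_on_Q: "semigroup_on (Q \<Gamma>) (qmul \<Gamma>)"
  by unfold_locales (auto simp: Q_eq qmul_wclass append_in_word_set)


section \<open>Paths and the semigroup \<open>S\<^sub>\<Gamma>\<close>\<close>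

definition nz_path :: "('v, 't) net \<Rightarrow> ('v, 't) symb list \<Rightarrow> bool" where
  "nz_path \<Gamma> p \<longleftrightarrow> p \<noteq> [] \<and> set p \<subseteq> T_symbs \<Gamma> \<union> T0_symbs \<Gamma> \<and>
     (\<forall>i. Suc i < length p \<longrightarrow> rng \<Gamma> (p ! i) \<inter> src \<Gamma> (p ! Suc i) \<noteq> {})"

definition path_rng :: "('v, 't) net \<Rightarrow> ('v, 't) symb list \<Rightarrow> 'v set" where
  "path_rng \<Gamma> p = rng \<Gamma> (last p)"

definition path_inv :: "('v, 't) symb list \<Rightarrow> ('v, 't) symb list" where
  "path_inv p = map symb_inv (rev p)"

definition linear_path :: "('v, 't) net \<Rightarrow> ('v, 't) symb list \<Rightarrow> bool" where
  "linear_path \<Gamma> p \<longleftrightarrow> (\<forall>i. Suc i < length p \<longrightarrow> rng \<Gamma> (p ! i) = src \<Gamma> (p ! Suc i))"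

definition reduced_path :: "('v, 't) net \<Rightarrow> ('v, 't) symb list \<Rightarrow> bool" where
  "reduced_path \<Gamma> p \<longleftrightarrow>
     (\<forall>i. Suc i < length p \<longrightarrow>
        p ! i \<noteq> VSet (src \<Gamma> (p ! Suc i)) \<and> p ! Suc i \<noteq> VSet (rng \<Gamma> (p ! i)))"

text \<open>The word \<open>[Zero]\<close> is the zero path.\<close>

definition RP :: "('v, 't) net \<Rightarrow> ('v, 't) symb list set" where
  "RP \<Gamma> = {p. nz_path \<Gamma> p \<and> reduced_path \<Gamma> p} \<union> {[Zero]}"

definition RLP :: "('v, 't) net \<Rightarrow> ('v, 't) symb list set" where
  "RLP \<Gamma> = {p. nz_path \<Gamma> p \<and> reduced_path \<Gamma> p \<and> linear_path \<Gamma> p}"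

text \<open>Elements of \<open>T\<^sup>0\<close> are paths of length one.\<close>

definition S_net :: "('v, 't) net \<Rightarrow> ('v, 't) symb list set set" where
  "S_net \<Gamma> =
     {wclass \<Gamma> (\<alpha> @ path_inv \<beta>) |\<alpha> \<beta>.
        \<alpha> \<in> RP \<Gamma> - {[Zero]} \<and> \<beta> \<in> RLP \<Gamma> - (\<lambda>A. [VSet A]) ` T0 \<Gamma> \<and>
        path_rng \<Gamma> \<alpha> = path_rng \<Gamma> \<beta>}
     \<union> {wclass \<Gamma> [Zero]}"

end

theory Submission
  imports Defs
begin

text \<open>Let \<open>G\<close> be the directed graph with vertex set \<open>T\<^sup>0\<close> that has, besides an edge
  \<open>t : s(t) \<rightarrow> r(t)\<close> for each relation, a jump edge \<open>A \<rightarrow> B\<close> for any two distinct sets \<open>A\<close>, \<open>B\<close> in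
  \<open>T\<^sup>0\<close> that meet. A product \<open>A B\<close> of two such sets is a jump, and a non-zero product \<open>t u\<close> with
  \<open>r(t) \<noteq> s(u)\<close> equals \<open>t r(t) s(u) u\<close>, with a hidden jump in the middle. Once all jumps are made
  explicit, reduced paths become arbitrary walks in \<open>G\<close>, and reduced linear paths outside \<open>T\<^sup>0\<close>
  become the non-empty walks that use no jumps. So each non-zero element of \<open>S\<^sub>\<Gamma>\<close> is
  \<open>p q\<inverse>\<close> for walks \<open>p\<close>, \<open>q\<close> with the same end, where \<open>q\<close> is non-empty and free of jumps.

  Two such elements multiply as in the graph inverse semigroup of \<open>G\<close>:
  \<open>(p q\<inverse>)(q z k\<inverse>) = p z k\<inverse>\<close>, \<open>(p (g z)\<inverse>)(g k\<inverse>) = p (k z)\<inverse>\<close>, and the product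
  is zero if neither of the two inner walks extends the other. The non-zero idempotents are
  therefore the elements \<open>q q\<inverse>\<close>, and \<open>S\<^sub>\<Gamma>\<close> sits in that inverse semigroup as a
  subsemigroup closed under \<open>x \<mapsto> x\<inverse> x\<close>; this is the reason for right ampleness. Concretely,
  \<open>q q\<inverse>\<close> is the idempotent L*-related to \<open>p q\<inverse>\<close>, because left multiplication by either
  of the two elements only puts \<open>p\<close> or \<open>q\<close> in front of the same walk.

  What needs work is that the pairs \<open>(p, q)\<close> are determined by their classes in \<open>Q\<^sub>\<Gamma>\<close>. As in
  van der Waerden's argument for free products, the symbols are made to act partially on the
  candidate normal forms by left multiplication. The action respects the defining relations
  (\<open>acts_ncong\<close>), so it separates classes (\<open>elt_inject\<close>), and it computes products of classes
  (\<open>acts_word\<close>), so that closure and the multiplication rules can be read off from it.\<close>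

section \<open>Idempotents and the relation L*\<close>

text \<open>Multiplying \<open>a\<close> or \<open>e\<close> by the adjoined identity gives the same as multiplying by \<open>e\<close>, so
  only factors in \<open>S\<close> matter. One of the two implications in the definition of L* then holds
  because \<open>a x = a (e x)\<close>.\<close>

lemma Lstar_idempotentI:
  assumes "semigroup_on S mul" "a \<in> S" "e \<in> idempotents S mul" "mul a e = a"
    and cancel: "\<And>x y. x \<in> S \<Longrightarrow> y \<in> S \<Longrightarrow> mul a x = mul a y \<Longrightarrow> mul e x = mul e y"
  shows "Lstar S mul a e"
proof -
  interpret semigroup_on S mul by fact
  have e: "e \<in> S" "mul e e = e"
    using assms(3) by (auto simp: idempotents_def)
  have iff: "mul a x = mul a y \<longleftrightarrow> mul e x = mul e y" if "x \<in> S" "y \<in> S" for x y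
    using cancel[OF that] assoc[OF \<open>a \<in> S\<close> e(1)] \<open>mul a e = a\<close> that by metis
  \<comment> \<open>\<open>r\<close> replaces the adjoined identity by \<open>e\<close>.\<close>
  define r where "r x = (case x of None \<Rightarrow> e | Some s \<Rightarrow> s)" for x
  have r: "r x \<in> S" "mul_one mul (Some a) x = Some (mul a (r x))"
    "mul_one mul (Some e) x = Some (mul e (r x))" if "x \<in> adjoin_one S mul" for x
    using that e \<open>mul a e = a\<close> by (auto simp: r_def adjoin_one_def split: if_splits)
  show ?thesis
    unfolding Lstar_def by (simp add: r iff)
qed

text \<open>An idempotent \<open>e\<close> gives \<open>e e = e 1\<close>, so \<open>e\<close> is a right identity for each member of its
  L*-class. For two L*-related idempotents this yields \<open>f e = f\<close> and \<open>e f = e\<close>.\<close>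

lemma Lstar_idempotent_unique:
  assumes "semigroup_on S mul" "e \<in> idempotents S mul" "f \<in> idempotents S mul"
    and "mul e f = mul f e" "Lstar S mul a e" "Lstar S mul a f"
  shows "e = f"
proof -
  interpret semigroup_on S mul by fact
  have ef: "e \<in> S" "f \<in> S" "mul e e = e" "mul f f = f"
    using assms by (auto simp: idempotents_def)
  have L: "mul_one mul (Some e) x = mul_one mul (Some e) y \<longleftrightarrow>
      mul_one mul (Some f) x = mul_one mul (Some f) y"
    if "x \<in> adjoin_one S mul" "y \<in> adjoin_one S mul" for x y
    using assms(5,6) that unfolding Lstar_def by metis
  have "\<exists>u\<in>adjoin_one S mul. \<forall>s\<in>S. mul_one mul (Some s) u = Some s"
  proof (cases "has_identity S mul")
    case True
    then obtain i where "i \<in> S" "\<forall>s\<in>S. mul s i = s" by (auto simp: has_identity_def)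
    with True show ?thesis by (intro bexI[of _ "Some i"]) (auto simp: adjoin_one_def)
  next
    case False
    then show ?thesis by (intro bexI[of _ None]) (auto simp: adjoin_one_def)
  qed
  then obtain u where u: "u \<in> adjoin_one S mul"
    "\<And>s. s \<in> S \<Longrightarrow> mul_one mul (Some s) u = Some s"
    by blast
  have "Some e \<in> adjoin_one S mul" "Some f \<in> adjoin_one S mul"
    using ef by (auto simp: adjoin_one_def)
  then have "mul f e = f" "mul e f = e"
    using L[OF _ u(1), of "Some e"] L[OF _ u(1), of "Some f"] ef u(2) by auto
  then show ?thesis
    using assms(4) by simp
qed

lemma star_eqI:
  assumes "semigroup_on S mul"
    and "\<And>e f. e \<in> idempotents S mul \<Longrightarrow> f \<in> idempotents S mul \<Longrightarrow> mul e f = mul f e"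
    and "e \<in> idempotents S mul" "Lstar S mul a e"
  shows "star S mul a = e"
  unfolding star_def
  using assms(3,4) Lstar_idempotent_unique[OF assms(1) _ _ assms(2)]
  by (intro the_equality) auto


section \<open>A partial action of the symbols on pairs of walks\<close>

text \<open>The triple \<open>(A, es, fs)\<close> stands for \<open>p q\<inverse>\<close>, where \<open>p\<close> is the walk with start \<open>A\<close> and
  edges \<open>es\<close>, and \<open>q\<close> is the walk with edges \<open>fs\<close>. In a list of edges, \<^term>\<open>Rel t\<close> is the edge of
  \<open>t\<close>, and \<^term>\<open>VSet B\<close> is the jump to \<open>B\<close> from the vertex reached so far.\<close>

type_synonym ('v, 't) state = "'v set \<times> ('v, 't) symb list \<times> ('v, 't) symb list"

text \<open>Multiplication by a set \<open>C\<close>: a jump from \<open>C\<close> to the start of the walk is put in front, if one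
  is needed; \<^const>\<open>None\<close> is the zero element.\<close>

fun enter :: "'v set \<Rightarrow> ('v, 't) state \<Rightarrow> ('v, 't) state option" where
  "enter C (A, es, fs) =
     (if C = A then Some (A, es, fs)
      else if C \<inter> A = {} then None else Some (C, VSet A # es, fs))"

text \<open>The inverse of \<open>t\<close> cancels a first edge \<open>t\<close> of \<open>p\<close>. If \<open>p\<close> is the empty walk at
  \<open>s(t)\<close>, then \<open>t\<inverse> q\<inverse> = (q t)\<inverse>\<close>, which is why \<open>t\<close> is appended to \<open>fs\<close>. Multiplication by
  \<open>t\<close> itself passes through \<open>r(t)\<close>, since \<open>t = t r(t)\<close>.\<close>

fun act :: "('v, 't) net \<Rightarrow> ('v, 't) symb \<Rightarrow> ('v, 't) state \<Rightarrow> ('v, 't) state option" where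
  "act \<Gamma> (VSet C) s = enter C s"
| "act \<Gamma> (Rel t) s = map_option (\<lambda>(A, es, fs). (nsrc \<Gamma> t, Rel t # es, fs)) (enter (nrng \<Gamma> t) s)"
| "act \<Gamma> (Inv t) (A, es, fs) =
     (if A \<noteq> nsrc \<Gamma> t then None
      else case es of
        [] \<Rightarrow> Some (nrng \<Gamma> t, [], fs @ [Rel t])
      | e # es' \<Rightarrow> if e = Rel t then Some (nrng \<Gamma> t, es', fs) else None)"
| "act \<Gamma> Zero s = None"

fun acts :: "('v, 't) net \<Rightarrow> ('v, 't) symb list \<Rightarrow> ('v, 't) state \<Rightarrow> ('v, 't) state option" where
  "acts \<Gamma> [] s = Some s"
| "acts \<Gamma> (x # w) s = Option.bind (acts \<Gamma> w s) (act \<Gamma> x)"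

lemma acts_append: "acts \<Gamma> (u @ v) s = Option.bind (acts \<Gamma> v s) (acts \<Gamma> u)"
proof (induction u)
  case Nil
  show ?case by (cases "acts \<Gamma> v s") auto
next
  case (Cons x u)
  then show ?case by (cases "acts \<Gamma> v s") auto
qed

lemma act_start:
  assumes "act \<Gamma> x s = Some (A, es, fs)"
  shows "A = src \<Gamma> x"
  using assms by (cases x; cases s) (auto split: if_splits list.splits)

lemma (in network) T0_nonempty: "A \<in> T0 \<Gamma> \<Longrightarrow> A \<noteq> {}"
  using src_nonempty rng_nonempty by (auto simp: T0_def)

lemma src_in_T0: "x \<in> nz_symbs \<Gamma> \<Longrightarrow> src \<Gamma> x \<in> T0 \<Gamma>"
  and rng_in_T0: "x \<in> nz_symbs \<Gamma> \<Longrightarrow> rng \<Gamma> x \<in> T0 \<Gamma>"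
  by (auto simp: nz_symbs_def T_symbs_def T0_symbs_def Tinv_symbs_def T0_def)

lemma nz_symbs_simps [simp]:
  "Rel t \<in> nz_symbs \<Gamma> \<longleftrightarrow> t \<in> rels \<Gamma>" "Inv t \<in> nz_symbs \<Gamma> \<longleftrightarrow> t \<in> rels \<Gamma>"
  "VSet A \<in> nz_symbs \<Gamma> \<longleftrightarrow> A \<in> T0 \<Gamma>" "Zero \<notin> nz_symbs \<Gamma>"
  by (auto simp: nz_symbs_def T_symbs_def T0_symbs_def Tinv_symbs_def)

lemma symbs_simps [simp]:
  "Rel t \<in> symbs \<Gamma> \<longleftrightarrow> t \<in> rels \<Gamma>" "Inv t \<in> symbs \<Gamma> \<longleftrightarrow> t \<in> rels \<Gamma>"
  "VSet A \<in> symbs \<Gamma> \<longleftrightarrow> A \<in> T0 \<Gamma>" "Zero \<in> symbs \<Gamma>"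
  by (auto simp: symbs_def)

lemma nz_symbs_symbs: "x \<in> nz_symbs \<Gamma> \<Longrightarrow> x \<in> symbs \<Gamma>"
  by (simp add: symbs_def)

text \<open>The result of applying a symbol \<open>x\<close> starts at \<open>src \<Gamma> x\<close> (\<open>act_start\<close>). Hence the
  source of \<open>x\<close> acts trivially on it, and a symbol whose range is disjoint from that source
  annihilates it. An inverse is applicable at its own range only, which accounts for the two
  asymmetric relations on products of an inverse with a relation or with a set.\<close>

lemma (in network) acts_NR:
  assumes "NR \<Gamma> u v"
  shows "acts \<Gamma> u s = acts \<Gamma> v s"
  using assms
proof cases
  case (NR1_src x)
  then show ?thesis
    using act_start[of \<Gamma> x s] by (cases "act \<Gamma> x s") auto
next
  case (NR1_rng x)
  then show ?thesis
    by (cases x; cases s) auto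
next
  case (NR2 x y)
  show ?thesis
  proof (cases "act \<Gamma> y s")
    case None
    with NR2 show ?thesis by simp
  next
    case (Some s')
    obtain A es fs where s': "s' = (A, es, fs)" by (cases s')
    have A: "A = src \<Gamma> y" using act_start Some s' by blast
    have "src \<Gamma> y \<noteq> {}" using NR2 src_in_T0 T0_nonempty by blast
    then have "act \<Gamma> x s' = None"
      using NR2 A s' by (cases x) auto
    then show ?thesis using NR2 Some by simp
  qed
next
  case (NR3 t u)
  then show ?thesis
    by (cases "act \<Gamma> (VSet (nrng \<Gamma> u)) s") auto
next
  case (NR4 t)
  then show ?thesis
    using act_start[of \<Gamma> "VSet (nrng \<Gamma> t)" s]
    by (cases "act \<Gamma> (VSet (nrng \<Gamma> t)) s") auto
next
  case (NR5 t A)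
  then have "Option.bind (act \<Gamma> (VSet A) s) (act \<Gamma> (Inv t)) = None"
    using act_start[of \<Gamma> "VSet A" s] by (cases "act \<Gamma> (VSet A) s") force+
  then show ?thesis using NR5 by simp
next
  case (NR6_left x)
  then show ?thesis
    by (cases "act \<Gamma> x s") auto
next
  case (NR6_right x)
  then show ?thesis by auto
qed

lemma (in network) acts_ncong:
  assumes "ncong \<Gamma> u v"
  shows "acts \<Gamma> u = acts \<Gamma> v"
  using assms
  by induction (auto simp: acts_append acts_NR intro!: ext)


section \<open>Reduction of words to normal form\<close>

text \<open>Walks in \<open>G\<close> from \<open>A\<close> to \<open>R\<close>. A jump is never trivial (\<open>A \<noteq> B\<close>); this makes the normal form
  unique, because \<open>A A = A\<close>.\<close>

fun walk :: "('v, 't) net \<Rightarrow> 'v set \<Rightarrow> ('v, 't) symb list \<Rightarrow> 'v set \<Rightarrow> bool" where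
  "walk \<Gamma> A [] R \<longleftrightarrow> A \<in> T0 \<Gamma> \<and> A = R"
| "walk \<Gamma> A (Rel t # es) R \<longleftrightarrow> t \<in> rels \<Gamma> \<and> A = nsrc \<Gamma> t \<and> walk \<Gamma> (nrng \<Gamma> t) es R"
| "walk \<Gamma> A (VSet B # es) R \<longleftrightarrow> A \<in> T0 \<Gamma> \<and> A \<noteq> B \<and> A \<inter> B \<noteq> {} \<and> walk \<Gamma> B es R"
| "walk \<Gamma> A (e # es) R \<longleftrightarrow> False"

lemma walk_T0: "walk \<Gamma> A es R \<Longrightarrow> A \<in> T0 \<Gamma> \<and> R \<in> T0 \<Gamma>"
  by (induction \<Gamma> A es R rule: walk.induct) (auto simp: T0_def)

lemma walk_symbs: "walk \<Gamma> A es R \<Longrightarrow> set es \<subseteq> T_symbs \<Gamma> \<union> T0_symbs \<Gamma>"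
  by (induction \<Gamma> A es R rule: walk.induct) (auto simp: T_symbs_def T0_symbs_def dest: walk_T0)

lemma walk_append: "walk \<Gamma> A (es @ fs) R \<longleftrightarrow> (\<exists>B. walk \<Gamma> A es B \<and> walk \<Gamma> B fs R)"
proof (induction es arbitrary: A)
  case Nil
  then show ?case by (auto dest: walk_T0)
next
  case (Cons e es)
  then show ?case by (cases e) auto
qed

text \<open>The normal forms of non-zero elements of \<open>S\<^sub>\<Gamma>\<close>. The start \<open>D\<close> of the walk \<open>fs\<close> is a function of
  \<open>fs\<close>, but an explicit name for it is convenient: it must agree with the start of the next factor
  for a product to be non-zero.\<close>

fun std :: "('v, 't) net \<Rightarrow> 'v set \<Rightarrow> ('v, 't) state \<Rightarrow> bool" where
  "std \<Gamma> D (A, es, fs) \<longleftrightarrow>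
     fs \<noteq> [] \<and> set fs \<subseteq> T_symbs \<Gamma> \<and> (\<exists>R. walk \<Gamma> A es R \<and> walk \<Gamma> D fs R)"

fun state_word :: "('v, 't) state \<Rightarrow> ('v, 't) symb list" where
  "state_word (A, es, fs) = VSet A # es @ path_inv fs"

fun result_word :: "('v, 't) state option \<Rightarrow> ('v, 't) symb list" where
  "result_word None = [Zero]"
| "result_word (Some s) = state_word s"

lemma path_inv_append: "path_inv (p @ q) = path_inv q @ path_inv p"
  by (simp add: path_inv_def)

lemma path_inv_simps [simp]:
  "path_inv [] = []" "path_inv (x # p) = path_inv p @ [symb_inv x]"
  by (simp_all add: path_inv_def)

lemma path_inv_symbs: "set p \<subseteq> T_symbs \<Gamma> \<Longrightarrow> set (path_inv p) \<subseteq> symbs \<Gamma>"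
  by (auto simp: path_inv_def T_symbs_def)

lemma path_symbs: "set p \<subseteq> T_symbs \<Gamma> \<union> T0_symbs \<Gamma> \<Longrightarrow> set p \<subseteq> symbs \<Gamma>"
  by (auto simp: symbs_def nz_symbs_def)

lemma state_word_symbs: "std \<Gamma> D s \<Longrightarrow> set (state_word s) \<subseteq> symbs \<Gamma>"
  by (cases s) (auto dest: walk_T0 walk_symbs path_inv_symbs path_symbs)

lemma state_word_in_word_set: "std \<Gamma> D s \<Longrightarrow> state_word s \<in> word_set \<Gamma>"
  using state_word_symbs[of \<Gamma> D s] by (cases s) (auto simp: word_set_def)

lemma ncong_context:
  assumes "ncong \<Gamma> u v" "set p \<subseteq> symbs \<Gamma>" "set q \<subseteq> symbs \<Gamma>"
  shows "ncong \<Gamma> (p @ u @ q) (p @ v @ q)"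
proof -
  have "ncong \<Gamma> q q" if "q \<noteq> []"
    using assms that by (intro ncong.refl) (auto simp: word_set_def)
  then have 1: "ncong \<Gamma> (u @ q) (v @ q)"
    using assms by (cases "q = []") (auto intro: ncong.mult)
  have "ncong \<Gamma> p p" if "p \<noteq> []"
    using assms that by (intro ncong.refl) (auto simp: word_set_def)
  then show ?thesis
    using 1 by (cases "p = []") (auto intro: ncong.mult)
qed

lemma NR_words: "NR \<Gamma> u v \<Longrightarrow> u \<in> word_set \<Gamma> \<and> v \<in> word_set \<Gamma>"
  by (induction rule: NR.induct)
    (use rng_in_T0[of "Rel _" \<Gamma>] in \<open>auto simp: word_set_def src_in_T0 rng_in_T0 nz_symbs_symbs\<close>)

lemma ncong_NR:
  assumes "NR \<Gamma> u v" "set p \<subseteq> symbs \<Gamma>" "set q \<subseteq> symbs \<Gamma>"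
  shows "ncong \<Gamma> (p @ u @ q) (p @ v @ q)"
  using assms by (blast intro: ncong_context ncong.base dest: NR_words)

lemma ncong_Zero_left: "set w \<subseteq> symbs \<Gamma> \<Longrightarrow> ncong \<Gamma> (Zero # w) [Zero]"
proof (induction w)
  case Nil
  then show ?case by (auto intro: ncong.refl simp: word_set_def)
next
  case (Cons x w)
  then have "ncong \<Gamma> ([] @ [Zero, x] @ w) ([] @ [Zero] @ w)"
    by (intro ncong_NR NR6_left) auto
  with Cons show ?case by (auto intro: ncong.trans)
qed

lemma ncong_NR_Zero:
  assumes "NR \<Gamma> u [Zero]" "set q \<subseteq> symbs \<Gamma>"
  shows "ncong \<Gamma> (u @ q) [Zero]"
  using ncong_NR[OF assms(1) _ assms(2), of "[]"] ncong_Zero_left[OF assms(2)]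
  by (auto intro: ncong.trans)

text \<open>The next lemmas show, symbol by symbol, that the action is left multiplication in
  \<open>Q\<^sub>\<Gamma>\<close> and preserves normal forms together with the start \<open>D\<close>, as \<open>fs\<close> only grows at
  its end.\<close>

lemma act_VSet_word:
  assumes "C \<in> T0 \<Gamma>" "std \<Gamma> D s"
  shows "ncong \<Gamma> (VSet C # state_word s) (result_word (act \<Gamma> (VSet C) s))
    \<and> pred_option (std \<Gamma> D) (act \<Gamma> (VSet C) s)"
proof -
  obtain A es fs where s: "s = (A, es, fs)" by (cases s)
  have A: "A \<in> T0 \<Gamma>" and q: "set (es @ path_inv fs) \<subseteq> symbs \<Gamma>"
    using assms state_word_symbs[of \<Gamma> D s] s by auto
  consider "C = A" | "C \<noteq> A" "C \<inter> A = {}" | "C \<noteq> A" "C \<inter> A \<noteq> {}" by blast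
  then show ?thesis
  proof cases
    case 1
    have "ncong \<Gamma> ([] @ [VSet A, VSet A] @ es @ path_inv fs) ([] @ [VSet A] @ es @ path_inv fs)"
      using NR1_src[of "VSet A" \<Gamma>] A q by (intro ncong_NR) auto
    then show ?thesis using 1 assms s by simp
  next
    case 2
    have "ncong \<Gamma> ([VSet C, VSet A] @ es @ path_inv fs) [Zero]"
      using 2 A assms q by (intro ncong_NR_Zero NR2) auto
    then show ?thesis using 2 s by simp
  next
    case 3
    have "VSet C # state_word s \<in> word_set \<Gamma>"
      using assms state_word_symbs[of \<Gamma> D s] by (auto simp: word_set_def)
    then show ?thesis using 3 assms s by (auto intro: ncong.refl)
  qed
qed

lemma act_Rel_word:
  assumes "t \<in> rels \<Gamma>" "std \<Gamma> D s"
  shows "ncong \<Gamma> (Rel t # state_word s) (result_word (act \<Gamma> (Rel t) s))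
    \<and> pred_option (std \<Gamma> D) (act \<Gamma> (Rel t) s)"
proof -
  let ?R = "nrng \<Gamma> t"
  have R: "?R \<in> T0 \<Gamma>" using assms by (auto simp: T0_def)
  have sw: "set (state_word s) \<subseteq> symbs \<Gamma>"
    using assms state_word_symbs by blast
  have "ncong \<Gamma> ([] @ [Rel t, VSet ?R] @ state_word s) ([] @ [Rel t] @ state_word s)"
    using NR1_rng[of "Rel t" \<Gamma>] assms sw by (intro ncong_NR) auto
  then have 1: "ncong \<Gamma> (Rel t # state_word s) (Rel t # VSet ?R # state_word s)"
    by (simp add: ncong.sym)
  have "ncong \<Gamma> ([Rel t] @ (VSet ?R # state_word s) @ [])
      ([Rel t] @ result_word (act \<Gamma> (VSet ?R) s) @ [])"
    using act_VSet_word[OF R assms(2)] assms by (intro ncong_context) auto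
  with 1 have 2: "ncong \<Gamma> (Rel t # state_word s) (Rel t # result_word (act \<Gamma> (VSet ?R) s))"
    by (auto intro: ncong.trans)
  show ?thesis
  proof (cases "act \<Gamma> (VSet ?R) s")
    case None
    have "ncong \<Gamma> ([Rel t, Zero] @ []) [Zero]"
      using assms by (intro ncong_NR_Zero NR6_right) auto
    with 2 None show ?thesis by (auto intro: ncong.trans)
  next
    case (Some s')
    obtain es fs where s': "s' = (?R, es, fs)"
      using act_start[of \<Gamma> "VSet ?R" s] Some by (cases s') auto
    have std: "std \<Gamma> D s'" using act_VSet_word[OF R assms(2)] Some by simp
    then have q: "set (es @ path_inv fs) \<subseteq> symbs \<Gamma>"
      using state_word_symbs[of \<Gamma> D s'] s' by auto
    have 3: "ncong \<Gamma> ([] @ [Rel t, VSet ?R] @ es @ path_inv fs) ([] @ [Rel t] @ es @ path_inv fs)"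
      using NR1_rng[of "Rel t" \<Gamma>] assms q by (intro ncong_NR) auto
    have 4: "ncong \<Gamma> ([] @ [VSet (nsrc \<Gamma> t), Rel t] @ es @ path_inv fs)
        ([] @ [Rel t] @ es @ path_inv fs)"
      using NR1_src[of "Rel t" \<Gamma>] assms q by (intro ncong_NR) auto
    have "ncong \<Gamma> (Rel t # state_word s) (VSet (nsrc \<Gamma> t) # Rel t # es @ path_inv fs)"
      using 2 3 4 Some s' by (auto intro: ncong.trans ncong.sym)
    then show ?thesis using std Some s' assms by auto
  qed
qed

lemma act_Inv_word:
  assumes "t \<in> rels \<Gamma>" "std \<Gamma> D s"
  shows "ncong \<Gamma> (Inv t # state_word s) (result_word (act \<Gamma> (Inv t) s))
    \<and> pred_option (std \<Gamma> D) (act \<Gamma> (Inv t) s)"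
proof -
  obtain A es fs where s: "s = (A, es, fs)" by (cases s)
  have A: "A \<in> T0 \<Gamma>" and q: "set (es @ path_inv fs) \<subseteq> symbs \<Gamma>"
    using assms state_word_symbs[of \<Gamma> D s] s by auto
  show ?thesis
  proof (cases "A = nsrc \<Gamma> t")
    case False
    have "ncong \<Gamma> ([Inv t, VSet A] @ es @ path_inv fs) [Zero]"
      using False A assms q by (intro ncong_NR_Zero NR5) auto
    then show ?thesis using False s by simp
  next
    case True
    have "ncong \<Gamma> ([] @ [Inv t, VSet A] @ es @ path_inv fs) ([] @ [Inv t] @ es @ path_inv fs)"
      using NR1_rng[of "Inv t" \<Gamma>] True assms q by (intro ncong_NR) auto
    then have 1: "ncong \<Gamma> (Inv t # state_word s) (Inv t # es @ path_inv fs)"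
      using s by simp
    consider "es = []" | es' where "es = Rel t # es'"
      | u es' where "es = Rel u # es'" "u \<noteq> t" "u \<in> rels \<Gamma>"
      | B es' where "es = VSet B # es'" "B \<noteq> A" "B \<in> T0 \<Gamma>"
    proof (cases es)
      case (Cons e es')
      then show ?thesis using that assms s by (cases e) (auto dest: walk_T0)
    qed (use that in auto)
    then show ?thesis
    proof cases
      case 1
      have "ncong \<Gamma> ([] @ [VSet (nrng \<Gamma> t), Inv t] @ path_inv fs) ([] @ [Inv t] @ path_inv fs)"
        using NR1_src[of "Inv t" \<Gamma>] assms q by (intro ncong_NR) auto
      then have "ncong \<Gamma> (Inv t # state_word s) (VSet (nrng \<Gamma> t) # path_inv (fs @ [Rel t]))"
        using \<open>ncong \<Gamma> (Inv t # state_word s) _\<close> 1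
        by (auto simp: path_inv_append intro: ncong.trans ncong.sym)
      moreover have "nrng \<Gamma> t \<in> T0 \<Gamma>"
        using assms by (auto simp: T0_def)
      ultimately show ?thesis
        using 1 s assms True by (auto simp: walk_append T_symbs_def)
    next
      case 2
      have "ncong \<Gamma> ([] @ [Inv t, Rel t] @ es' @ path_inv fs)
          ([] @ [VSet (nrng \<Gamma> t)] @ es' @ path_inv fs)"
        using assms q 2 by (intro ncong_NR NR4) auto
      with 1 2 have "ncong \<Gamma> (Inv t # state_word s) (VSet (nrng \<Gamma> t) # es' @ path_inv fs)"
        by (auto intro: ncong.trans)
      then show ?thesis using 2 s assms True by auto
    next
      case 3
      have "ncong \<Gamma> ([Inv t, Rel u] @ es' @ path_inv fs) [Zero]"
        using 3 assms q by (intro ncong_NR_Zero NR3) auto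
      with 1 3 show ?thesis using s True by (auto intro: ncong.trans)
    next
      case 4
      have "ncong \<Gamma> ([Inv t, VSet B] @ es' @ path_inv fs) [Zero]"
        using 4 True assms q by (intro ncong_NR_Zero NR5) auto
      with 1 4 show ?thesis using s True by (auto intro: ncong.trans)
    qed
  qed
qed

lemma act_word:
  assumes "x \<in> symbs \<Gamma>" "std \<Gamma> D s"
  shows "ncong \<Gamma> (x # state_word s) (result_word (act \<Gamma> x s))"
    and "pred_option (std \<Gamma> D) (act \<Gamma> x s)"
proof -
  have "ncong \<Gamma> (x # state_word s) (result_word (act \<Gamma> x s))
    \<and> pred_option (std \<Gamma> D) (act \<Gamma> x s)"
  proof (cases x)
    case (VSet C)
    then show ?thesis using act_VSet_word[of C \<Gamma> D s] assms by simp
  next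
    case (Rel t)
    then show ?thesis using act_Rel_word[of t \<Gamma> D s] assms by simp
  next
    case (Inv t)
    then show ?thesis using act_Inv_word[of t \<Gamma> D s] assms by simp
  next
    case Zero
    then show ?thesis
      using ncong_Zero_left[OF state_word_symbs[OF assms(2)]] by simp
  qed
  then show "ncong \<Gamma> (x # state_word s) (result_word (act \<Gamma> x s))"
    and "pred_option (std \<Gamma> D) (act \<Gamma> x s)" by auto
qed

text \<open>Normalization: a word in front of a normal form can be absorbed into it by the action.
  Products in \<open>S\<^sub>\<Gamma>\<close> are computed in this way.\<close>

lemma acts_word:
  assumes "set w \<subseteq> symbs \<Gamma>" "std \<Gamma> D s"
  shows "ncong \<Gamma> (w @ state_word s) (result_word (acts \<Gamma> w s))
    \<and> pred_option (std \<Gamma> D) (acts \<Gamma> w s)"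
  using assms(1)
proof (induction w)
  case Nil
  then show ?case
    using assms(2) by (auto intro: ncong.refl state_word_in_word_set)
next
  case (Cons x w)
  then have "ncong \<Gamma> ([x] @ (w @ state_word s) @ []) ([x] @ result_word (acts \<Gamma> w s) @ [])"
    by (intro ncong_context) auto
  then have 1: "ncong \<Gamma> (x # w @ state_word s) (x # result_word (acts \<Gamma> w s))" by simp
  show ?case
  proof (cases "acts \<Gamma> w s")
    case None
    have "ncong \<Gamma> ([] @ [x, Zero] @ []) ([] @ [Zero] @ [])"
      using Cons.prems by (intro ncong_NR NR6_right) auto
    with 1 None show ?thesis by (auto intro: ncong.trans)
  next
    case (Some s')
    then show ?thesis
      using 1 Cons act_word[of x \<Gamma> D s'] by (auto intro: ncong.trans)
  qed
qed


section \<open>The action of normal forms on each other\<close>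

text \<open>The state with edges \<open>gs\<close> starts at \<open>R\<close>, where the walk \<open>es\<close> ends, so no jump arises at the
  seam and the two walks are simply concatenated.\<close>

lemma acts_walk:
  assumes "walk \<Gamma> A es R"
  shows "acts \<Gamma> (VSet A # es) (R, gs, hs) = Some (A, es @ gs, hs)"
  using assms
proof (induction es arbitrary: A)
  case Nil
  then show ?case by simp
next
  case (Cons e es)
  then show ?case
  proof (cases e)
    case (Rel t)
    then show ?thesis
      using Cons.IH[of "nrng \<Gamma> t"] Cons.prems
      by (cases "acts \<Gamma> es (R, gs, hs)") auto
  next
    case (VSet B)
    then show ?thesis
      using Cons.IH[of B] Cons.prems by auto
  qed auto
qed

text \<open>The action of \<open>q\<inverse>\<close> on a state whose walk starts where \<open>q\<close> starts: common edges cancel, and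
  the first difference gives zero. If the walk of the state is used up, the remaining edges of \<open>q\<close>
  accumulate in the third component.\<close>

lemma acts_path_inv_extend:
  assumes "walk \<Gamma> C fs R" "set fs \<subseteq> T_symbs \<Gamma>"
  shows "acts \<Gamma> (path_inv fs) (C, fs @ zs, hs) = Some (R, zs, hs)"
  using assms
  by (induction fs arbitrary: C) (auto simp: T_symbs_def acts_append)

lemma acts_path_inv_accumulate:
  assumes "walk \<Gamma> C zs R" "set zs \<subseteq> T_symbs \<Gamma>"
  shows "acts \<Gamma> (path_inv zs) (C, [], hs) = Some (R, [], hs @ zs)"
  using assms
  by (induction zs arbitrary: C hs) (auto simp: T_symbs_def acts_append)

lemma acts_path_inv_mismatch:
  assumes "walk \<Gamma> C fs R" "set fs \<subseteq> T_symbs \<Gamma>"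
    and "\<nexists>zs. gs = fs @ zs" "\<nexists>zs. fs = gs @ zs"
  shows "acts \<Gamma> (path_inv fs) (C, gs, hs) = None"
  using assms
proof (induction fs arbitrary: C gs)
  case (Cons f fs)
  obtain t where t: "f = Rel t" "t \<in> rels \<Gamma>" using Cons.prems by (auto simp: T_symbs_def)
  obtain g gs' where gs: "gs = g # gs'" using Cons.prems by (cases gs) auto
  show ?case
    using Cons.prems Cons.IH[of "nrng \<Gamma> t" gs'] t gs by (auto simp: acts_append)
qed auto

lemma acts_path_inv_other_start:
  assumes "walk \<Gamma> C fs R" "set fs \<subseteq> T_symbs \<Gamma>" "fs \<noteq> []" "C' \<noteq> C"
  shows "acts \<Gamma> (path_inv fs) (C', gs, hs) = None"
proof -
  obtain t fs' where t: "fs = Rel t # fs'"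
    using assms by (cases fs) (auto simp: T_symbs_def)
  then have "C' \<noteq> nsrc \<Gamma> t" using assms by simp
  then show ?thesis using t by (simp add: acts_append)
qed

lemma acts_state_word:
  "acts \<Gamma> (state_word (A, es, fs)) s =
    Option.bind (acts \<Gamma> (path_inv fs) s) (acts \<Gamma> (VSet A # es))"
  using acts_append[of \<Gamma> "VSet A # es" "path_inv fs" s] by simp

lemma acts_state_word_extend:
  assumes "std \<Gamma> C (A, es, fs)"
  shows "acts \<Gamma> (state_word (A, es, fs)) (C, fs @ zs, hs) = Some (A, es @ zs, hs)"
proof -
  obtain R where "walk \<Gamma> A es R" "walk \<Gamma> C fs R" "set fs \<subseteq> T_symbs \<Gamma>"
    using assms by auto
  then show ?thesis
    by (simp only: acts_state_word acts_path_inv_extend acts_walk bind.simps)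
qed

lemma acts_state_word_absorb:
  assumes "std \<Gamma> C (A, es, gs @ zs)"
  shows "acts \<Gamma> (state_word (A, es, gs @ zs)) (C, gs, hs) = Some (A, es, hs @ zs)"
proof -
  obtain R B where w: "walk \<Gamma> A es R" "walk \<Gamma> C gs B" "walk \<Gamma> B zs R"
    and sub: "set gs \<subseteq> T_symbs \<Gamma>" "set zs \<subseteq> T_symbs \<Gamma>"
    using assms by (auto simp: walk_append)
  have "acts \<Gamma> (path_inv (gs @ zs)) (C, gs, hs) = Some (R, [], hs @ zs)"
    using acts_path_inv_extend[OF w(2) sub(1), of "[]"] acts_path_inv_accumulate[OF w(3) sub(2)]
    by (simp add: path_inv_append acts_append)
  then show ?thesis
    using acts_walk[OF w(1), of "[]" "hs @ zs"] by (simp only: acts_state_word bind.simps) simp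
qed

lemma acts_state_word_None:
  assumes "std \<Gamma> C (A, es, fs)"
    and "C' \<noteq> C \<or> (\<nexists>zs. gs = fs @ zs) \<and> (\<nexists>zs. fs = gs @ zs)"
  shows "acts \<Gamma> (state_word (A, es, fs)) (C', gs, hs) = None"
proof -
  obtain R where w: "walk \<Gamma> A es R" "walk \<Gamma> C fs R" "set fs \<subseteq> T_symbs \<Gamma>" "fs \<noteq> []"
    using assms by auto
  then have "acts \<Gamma> (path_inv fs) (C', gs, hs) = None"
    using assms(2) acts_path_inv_mismatch acts_path_inv_other_start by metis
  then show ?thesis
    by (simp only: acts_state_word bind.simps)
qed


section \<open>The elements of \<open>S\<^sub>\<Gamma>\<close>\<close>

abbreviation zero :: "('v, 't) net \<Rightarrow> ('v, 't) symb list set" where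
  "zero \<Gamma> \<equiv> wclass \<Gamma> [Zero]"

definition elt :: "('v, 't) net \<Rightarrow> ('v, 't) state \<Rightarrow> ('v, 't) symb list set" where
  "elt \<Gamma> s = wclass \<Gamma> (state_word s)"

lemma wclass_eq_iff:
  assumes "u \<in> word_set \<Gamma>" "v \<in> word_set \<Gamma>"
  shows "wclass \<Gamma> u = wclass \<Gamma> v \<longleftrightarrow> ncong \<Gamma> u v"
  using eq_equiv_class_iff[OF equiv_ncong_rel assms] by (simp add: wclass_def ncong_rel_def)

lemma ncong_wclass: "ncong \<Gamma> u v \<Longrightarrow> wclass \<Gamma> u = wclass \<Gamma> v"
  using wclass_eq_iff ncong_words by blast

lemma Zero_in_word_set: "[Zero] \<in> word_set \<Gamma>"
  by (simp add: word_set_def)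

lemma (in network) elt_neq_zero:
  assumes "std \<Gamma> D s"
  shows "elt \<Gamma> s \<noteq> zero \<Gamma>"
proof
  assume "elt \<Gamma> s = zero \<Gamma>"
  then have "ncong \<Gamma> (state_word s) [Zero]"
    using assms by (simp add: elt_def wclass_eq_iff state_word_in_word_set Zero_in_word_set)
  then have "acts \<Gamma> (state_word s) = acts \<Gamma> [Zero]" by (rule acts_ncong)
  moreover obtain A es fs where s: "s = (A, es, fs)" by (cases s)
  ultimately show False
    using acts_state_word_extend[of \<Gamma> D A es fs "[]" "[]"] assms by (simp del: state_word.simps)
qed

text \<open>A normal form is recovered from its class by letting it act on the empty walk at \<open>D\<close>, that is,
  on \<open>(D, [], [])\<close>. At any other vertex \<open>D'\<close> the action gives zero, because the walk \<open>fs\<close>, being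
  non-empty, cancels only edges of walks that start at \<open>D\<close>.\<close>

lemma (in network) elt_inject:
  assumes "std \<Gamma> D s" "std \<Gamma> D' s'" "elt \<Gamma> s = elt \<Gamma> s'"
  shows "s = s' \<and> D = D'"
proof -
  obtain A es fs where s: "s = (A, es, fs)" by (cases s)
  obtain A' es' fs' where s': "s' = (A', es', fs')" by (cases s')
  have "acts \<Gamma> (state_word s) = acts \<Gamma> (state_word s')"
    using assms by (intro acts_ncong) (simp add: elt_def wclass_eq_iff state_word_in_word_set)
  \<comment> \<open>On the empty walk at \<open>D\<close> nothing cancels, so the whole of \<open>fs\<close> accumulates.\<close>
  moreover have "acts \<Gamma> (state_word s) (D, [], []) = Some (A, es, fs)"
    using acts_state_word_absorb[of \<Gamma> D A es "[]" fs "[]"] assms s by simp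
  moreover have "acts \<Gamma> (state_word s') (D', [], []) = Some (A', es', fs')"
    using acts_state_word_absorb[of \<Gamma> D' A' es' "[]" fs' "[]"] assms s' by simp
  moreover have "acts \<Gamma> (state_word s') (D, [], []) = None" if "D \<noteq> D'"
    using acts_state_word_None[of \<Gamma> D' A' es' fs' D] assms s' that by simp
  ultimately show ?thesis using s s' by (cases "D = D'") auto
qed

lemma nz_path_successively:
  "nz_path \<Gamma> p \<longleftrightarrow> p \<noteq> [] \<and> set p \<subseteq> T_symbs \<Gamma> \<union> T0_symbs \<Gamma>
    \<and> successively (\<lambda>x y. rng \<Gamma> x \<inter> src \<Gamma> y \<noteq> {}) p"
  by (simp add: nz_path_def successively_conv_nth)

lemma linear_path_successively: "linear_path \<Gamma> p \<longleftrightarrow> successively (\<lambda>x y. rng \<Gamma> x = src \<Gamma> y) p"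
  by (simp add: linear_path_def successively_conv_nth)

lemma reduced_path_successively:
  "reduced_path \<Gamma> p \<longleftrightarrow> successively (\<lambda>x y. x \<noteq> VSet (src \<Gamma> y) \<and> y \<noteq> VSet (rng \<Gamma> x)) p"
  by (simp add: reduced_path_def successively_conv_nth)

lemma linear_path_walk:
  assumes "p \<noteq> []" "set p \<subseteq> T_symbs \<Gamma>" "linear_path \<Gamma> p"
  shows "walk \<Gamma> (src \<Gamma> (hd p)) p (path_rng \<Gamma> p)"
  using assms
proof (induction p rule: induct_list012)
  case (2 x)
  then show ?case by (auto simp: T_symbs_def path_rng_def T0_def)
next
  case (3 x y p)
  then show ?case by (auto simp: T_symbs_def path_rng_def linear_path_successively)
qed simp

text \<open>In a linear path a set next to another symbol would equal the source or range of that symbol,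
  which reducedness forbids. So a reduced linear path with an entry in \<open>T\<^sup>0\<close> has length one.\<close>

lemma RLP_rels:
  assumes "p \<in> RLP \<Gamma> - (\<lambda>A. [VSet A]) ` T0 \<Gamma>"
  shows "set p \<subseteq> T_symbs \<Gamma>"
proof -
  have sub: "set p \<subseteq> T_symbs \<Gamma> \<union> T0_symbs \<Gamma>" and lin: "linear_path \<Gamma> p" and red: "reduced_path \<Gamma> p"
    using assms by (auto simp: RLP_def nz_path_def)
  have "p = [VSet A]" if "VSet A \<in> set p" for A
  proof -
    obtain i where i: "i < length p" "p ! i = VSet A"
      using \<open>VSet A \<in> set p\<close> unfolding in_set_conv_nth by blast
    have "\<not> Suc i < length p"
    proof
      assume "Suc i < length p"
      then have "rng \<Gamma> (p ! i) = src \<Gamma> (p ! Suc i)" "p ! i \<noteq> VSet (src \<Gamma> (p ! Suc i))"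
        using lin red by (auto simp: linear_path_def reduced_path_def)
      then show False using i by simp
    qed
    moreover have "i = 0"
    proof (rule ccontr)
      assume "i \<noteq> 0"
      then obtain j where j: "i = Suc j" by (cases i) auto
      then have "rng \<Gamma> (p ! j) = src \<Gamma> (p ! i)" "p ! i \<noteq> VSet (rng \<Gamma> (p ! j))"
        using i lin red by (auto simp: linear_path_def reduced_path_def)
      then show False using i by simp
    qed
    ultimately have "length p = 1" using i by simp
    then show ?thesis using i \<open>i = 0\<close> by (cases p) auto
  qed
  then have "VSet A \<notin> set p" if "A \<in> T0 \<Gamma>" for A
    using assms \<open>A \<in> T0 \<Gamma>\<close> by blast
  then show ?thesis
    using sub by (auto simp: T0_symbs_def)
qed

lemma walk_RLP:
  assumes "walk \<Gamma> D p R" "set p \<subseteq> T_symbs \<Gamma>" "p \<noteq> []"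
  shows "linear_path \<Gamma> p \<and> reduced_path \<Gamma> p \<and> path_rng \<Gamma> p = R"
  using assms
proof (induction p arbitrary: D rule: induct_list012)
  case (2 x)
  then show ?case
    by (auto simp: T_symbs_def path_rng_def linear_path_def reduced_path_def)
next
  case (3 x y p)
  then show ?case
    by (auto simp: T_symbs_def path_rng_def linear_path_successively reduced_path_successively)
qed simp

lemma (in network) walk_nz_path:
  assumes "walk \<Gamma> D p R" "set p \<subseteq> T_symbs \<Gamma>" "p \<noteq> []"
  shows "nz_path \<Gamma> p"
  using assms
proof (induction p arbitrary: D rule: induct_list012)
  case (3 x y p)
  then show ?case
    using src_nonempty by (auto simp: T_symbs_def nz_path_successively)
qed (auto simp: nz_path_def)

text \<open>A walk becomes a reduced path when each set that equals the source or the range of a neighbour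
  is dropped. Going backwards along the walk, only two places can be affected: the start \<open>A\<close>,
  which is absorbed by a first edge \<open>t\<close>, and a leading \<open>r(t)\<close> of the path built so far, which the
  relation \<open>t r(t) = t\<close> removes.\<close>

lemma (in network) walk_reduced_path:
  assumes "walk \<Gamma> A es R"
  shows "\<exists>p. nz_path \<Gamma> p \<and> reduced_path \<Gamma> p \<and> src \<Gamma> (hd p) = A \<and> path_rng \<Gamma> p = R
    \<and> ncong \<Gamma> (VSet A # es) p"
  using assms
proof (induction es arbitrary: A)
  case Nil
  then show ?case
    by (intro exI[of _ "[VSet A]"])
      (auto simp: nz_path_def reduced_path_def path_rng_def T0_symbs_def word_set_def
        intro: ncong.refl)
next
  case (Cons e es)
  have es: "set es \<subseteq> symbs \<Gamma>" using walk_symbs[OF Cons.prems] path_symbs by fastforce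
  show ?case
  proof (cases e)
    case (VSet B)
    then obtain p where p: "nz_path \<Gamma> p" "reduced_path \<Gamma> p" "src \<Gamma> (hd p) = B" "path_rng \<Gamma> p = R"
      "ncong \<Gamma> (VSet B # es) p"
      using Cons by auto
    have A: "A \<in> T0 \<Gamma>" "A \<noteq> B" "A \<inter> B \<noteq> {}" using Cons VSet by auto
    obtain x q where xq: "p = x # q" using p by (cases p) (auto simp: nz_path_def)
    have "ncong \<Gamma> ([VSet A] @ (VSet B # es) @ []) ([VSet A] @ p @ [])"
      using p A by (intro ncong_context) auto
    then show ?thesis
      using p A xq VSet by (intro exI[of _ "VSet A # p"])
        (auto simp: nz_path_successively reduced_path_successively path_rng_def T0_symbs_def)
  next
    case (Rel t)
    let ?B = "nrng \<Gamma> t"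
    have t: "t \<in> rels \<Gamma>" "A = nsrc \<Gamma> t" using Cons Rel by auto
    obtain p where p: "nz_path \<Gamma> p" "reduced_path \<Gamma> p" "src \<Gamma> (hd p) = ?B" "path_rng \<Gamma> p = R"
      "ncong \<Gamma> (VSet ?B # es) p"
      using Cons Rel by auto
    obtain x q where xq: "p = x # q" using p by (cases p) (auto simp: nz_path_def)
    have pT: "set p \<subseteq> symbs \<Gamma>" using p path_symbs by (auto simp: nz_path_def)
    have 1: "ncong \<Gamma> ([] @ [VSet A, Rel t] @ es) ([] @ [Rel t] @ es)"
      using NR1_src[of "Rel t" \<Gamma>] t es by (intro ncong_NR) auto
    have 2: "ncong \<Gamma> ([] @ [Rel t, VSet ?B] @ es) ([] @ [Rel t] @ es)"
      using NR1_rng[of "Rel t" \<Gamma>] t es by (intro ncong_NR) auto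
    have "ncong \<Gamma> ([Rel t] @ (VSet ?B # es) @ []) ([Rel t] @ p @ [])"
      using p t by (intro ncong_context) auto
    then have 3: "ncong \<Gamma> (VSet A # Rel t # es) (Rel t # p)"
      using ncong.trans[OF 1 ncong.sym[OF 2]] by (auto intro: ncong.trans)
    show ?thesis
    proof (cases "x = VSet ?B")
      case False
      then show ?thesis
        using p t xq 3 Rel rng_nonempty[of t] by (intro exI[of _ "Rel t # p"])
          (auto simp: nz_path_successively reduced_path_successively path_rng_def T_symbs_def)
    next
      case True
      have "ncong \<Gamma> ([] @ [Rel t, VSet ?B] @ q) ([] @ [Rel t] @ q)"
        using NR1_rng[of "Rel t" \<Gamma>] t pT xq by (intro ncong_NR) auto
      then have 4: "ncong \<Gamma> (VSet A # Rel t # es) (Rel t # q)"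
        using 3 True xq by (auto intro: ncong.trans)
      show ?thesis
        using p t xq 4 Rel True by (intro exI[of _ "Rel t # q"])
          (cases q; auto simp: nz_path_successively reduced_path_successively path_rng_def T_symbs_def)
    qed
  qed (use Cons in auto)
qed

text \<open>For the inclusion from left to right, \<open>q\<inverse>\<close> is the normal form with an empty first walk at
  the end of \<open>q\<close>, and the path \<open>p\<close> is absorbed by \<open>acts_word\<close>.\<close>

lemma (in network) S_net_eq: "S_net \<Gamma> = insert (zero \<Gamma>) {elt \<Gamma> s |D s. std \<Gamma> D s}"
proof (intro equalityI subsetI)
  fix a assume "a \<in> S_net \<Gamma>"
  then consider "a = zero \<Gamma>" | p q where "a = wclass \<Gamma> (p @ path_inv q)" "nz_path \<Gamma> p"
    "q \<in> RLP \<Gamma> - (\<lambda>A. [VSet A]) ` T0 \<Gamma>"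
    unfolding S_net_def RP_def by blast
  then show "a \<in> insert (zero \<Gamma>) {elt \<Gamma> s |D s. std \<Gamma> D s}"
  proof cases
    case 2
    let ?R = "path_rng \<Gamma> q" and ?D = "src \<Gamma> (hd q)"
    have q: "q \<noteq> []" "linear_path \<Gamma> q" "set q \<subseteq> T_symbs \<Gamma>"
      using 2 RLP_rels by (auto simp: RLP_def nz_path_def)
    then have w: "walk \<Gamma> ?D q ?R" by (intro linear_path_walk)
    then have std: "std \<Gamma> ?D (?R, [], q)" using q walk_T0 by fastforce
    have ps: "set p \<subseteq> symbs \<Gamma>" using 2 path_symbs by (auto simp: nz_path_def)
    obtain q' t where q': "q = q' @ [Rel t]" "t \<in> rels \<Gamma>"
      using q by (cases q rule: rev_cases) (auto simp: T_symbs_def)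
    have "ncong \<Gamma> (p @ [VSet ?R, Inv t] @ path_inv q') (p @ [Inv t] @ path_inv q')"
      using NR1_src[of "Inv t" \<Gamma>] q' ps q path_inv_symbs[of q' \<Gamma>]
      by (intro ncong_NR) (auto simp: path_rng_def)
    then have "ncong \<Gamma> (p @ state_word (?R, [], q)) (p @ path_inv q)"
      using q' by (simp add: path_inv_append)
    then have "a = wclass \<Gamma> (result_word (acts \<Gamma> p (?R, [], q)))"
      using 2 acts_word[OF ps std] ncong_wclass by metis
    moreover have "pred_option (std \<Gamma> ?D) (acts \<Gamma> p (?R, [], q))"
      using acts_word[OF ps std] by blast
    ultimately have "a = zero \<Gamma> \<or> (\<exists>s. a = elt \<Gamma> s \<and> std \<Gamma> ?D s)"
      by (cases "acts \<Gamma> p (?R, [], q)") (simp_all only: elt_def result_word.simps option.pred_inject, blast+)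
    then show ?thesis by blast
  qed simp
next
  fix a assume "a \<in> insert (zero \<Gamma>) {elt \<Gamma> s |D s. std \<Gamma> D s}"
  then consider "a = zero \<Gamma>" | D s where "a = elt \<Gamma> s" "std \<Gamma> D s"
    by blast
  then show "a \<in> S_net \<Gamma>"
  proof cases
    case (2 D s)
    obtain A es fs where s: "s = (A, es, fs)" by (cases s)
    with 2 obtain R where R: "walk \<Gamma> A es R" "walk \<Gamma> D fs R" "fs \<noteq> []" "set fs \<subseteq> T_symbs \<Gamma>"
      by auto
    obtain p where p: "nz_path \<Gamma> p" "reduced_path \<Gamma> p" "path_rng \<Gamma> p = R"
      "ncong \<Gamma> (VSet A # es) p"
      using walk_reduced_path[OF R(1)] by blast
    have "ncong \<Gamma> ([] @ (VSet A # es) @ path_inv fs) ([] @ p @ path_inv fs)"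
      using p R path_inv_symbs by (intro ncong_context) auto
    then have "a = wclass \<Gamma> (p @ path_inv fs)"
      using 2 s by (simp add: elt_def ncong_wclass)
    moreover have "p \<in> RP \<Gamma> - {[Zero]}"
      using p by (auto simp: RP_def nz_path_def T_symbs_def T0_symbs_def)
    moreover have "fs \<in> RLP \<Gamma> - (\<lambda>A. [VSet A]) ` T0 \<Gamma>" "path_rng \<Gamma> fs = R"
      using R walk_RLP[OF R(2)] walk_nz_path[OF R(2)] by (auto simp: RLP_def T_symbs_def)
    ultimately show ?thesis using p unfolding S_net_def by blast
  qed (simp add: S_net_def)
qed

declare std.simps [simp del] state_word.simps [simp del]

lemma qmul_elt:
  assumes "std \<Gamma> C s" "std \<Gamma> D s'"
  shows "qmul \<Gamma> (elt \<Gamma> s) (elt \<Gamma> s') = wclass \<Gamma> (result_word (acts \<Gamma> (state_word s) s'))"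
    and "pred_option (std \<Gamma> D) (acts \<Gamma> (state_word s) s')"
  using assms acts_word[OF state_word_symbs[OF assms(1)] assms(2)]
  by (auto simp: elt_def qmul_wclass state_word_in_word_set ncong_wclass)

text \<open>The multiplication rules of the graph inverse semigroup of \<open>G\<close>.\<close>

lemma elt_mult_extend:
  assumes "std \<Gamma> C (A, es, fs)" "std \<Gamma> D (C, fs @ zs, hs)"
  shows "qmul \<Gamma> (elt \<Gamma> (A, es, fs)) (elt \<Gamma> (C, fs @ zs, hs)) = elt \<Gamma> (A, es @ zs, hs)"
    and "std \<Gamma> D (A, es @ zs, hs)"
  using qmul_elt[OF assms] acts_state_word_extend[OF assms(1)]
  by (simp_all add: elt_def)

lemma elt_mult_absorb:
  assumes "std \<Gamma> C (A, es, gs @ zs)" "std \<Gamma> D (C, gs, hs)"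
  shows "qmul \<Gamma> (elt \<Gamma> (A, es, gs @ zs)) (elt \<Gamma> (C, gs, hs)) = elt \<Gamma> (A, es, hs @ zs)"
    and "std \<Gamma> D (A, es, hs @ zs)"
  using qmul_elt[OF assms] acts_state_word_absorb[OF assms(1)]
  by (simp_all add: elt_def)

lemma elt_mult_zero:
  assumes "std \<Gamma> C (A, es, fs)" "std \<Gamma> D (C', gs, hs)"
    and "C' \<noteq> C \<or> (\<nexists>zs. gs = fs @ zs) \<and> (\<nexists>zs. fs = gs @ zs)"
  shows "qmul \<Gamma> (elt \<Gamma> (A, es, fs)) (elt \<Gamma> (C', gs, hs)) = zero \<Gamma>"
  using qmul_elt[OF assms(1,2)] acts_state_word_None[OF assms(1,3)]
  by (simp add: elt_def)

lemma mult_cases: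
  obtains "C' \<noteq> C \<or> (\<nexists>zs. gs = fs @ zs) \<and> (\<nexists>zs. fs = gs @ zs)"
  | zs where "C' = C" "gs = fs @ zs"
  | zs where "C' = C" "fs = gs @ zs"
  by blast

lemma qmul_zero:
  assumes "a \<in> Q \<Gamma>"
  shows "qmul \<Gamma> (zero \<Gamma>) a = zero \<Gamma>" "qmul \<Gamma> a (zero \<Gamma>) = zero \<Gamma>"
proof -
  obtain w where w: "w \<in> word_set \<Gamma>" "a = wclass \<Gamma> w"
    using assms by (auto simp: Q_eq)
  have "ncong \<Gamma> (Zero # w) [Zero]"
    using w by (intro ncong_Zero_left) (auto simp: word_set_def)
  then show "qmul \<Gamma> (zero \<Gamma>) a = zero \<Gamma>"
    using w by (simp add: qmul_wclass Zero_in_word_set ncong_wclass)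
  have "set w \<subseteq> symbs \<Gamma> \<Longrightarrow> ncong \<Gamma> (w @ [Zero]) [Zero]"
  proof (induction w)
    case Nil
    show ?case using ncong.refl[OF Zero_in_word_set] by simp
  next
    case (Cons x w)
    then have "ncong \<Gamma> ([x] @ (w @ [Zero]) @ []) ([x] @ [Zero] @ [])"
      by (intro ncong_context) auto
    moreover have "ncong \<Gamma> ([] @ [x, Zero] @ []) ([] @ [Zero] @ [])"
      using Cons.prems by (intro ncong_NR NR6_right) auto
    ultimately show ?case by (auto intro: ncong.trans)
  qed
  then show "qmul \<Gamma> a (zero \<Gamma>) = zero \<Gamma>"
    using w by (auto simp: qmul_wclass Zero_in_word_set ncong_wclass word_set_def)
qed


section \<open>Right ampleness\<close>

context network
begin

lemma S_net_cases:
  assumes "a \<in> S_net \<Gamma>"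
  obtains "a = zero \<Gamma>"
  | D A es fs where "a = elt \<Gamma> (A, es, fs)" "std \<Gamma> D (A, es, fs)"
proof -
  from assms consider "a = zero \<Gamma>" | D s where "a = elt \<Gamma> s" "std \<Gamma> D s"
    unfolding S_net_eq by blast
  then show thesis by cases (use that in auto)
qed

lemma elt_in_S_net: "std \<Gamma> D s \<Longrightarrow> elt \<Gamma> s \<in> S_net \<Gamma>"
  and zero_in_S_net: "zero \<Gamma> \<in> S_net \<Gamma>"
  unfolding S_net_eq by blast+

lemma S_net_subset_Q: "S_net \<Gamma> \<subseteq> Q \<Gamma>"
  by (auto simp: S_net_eq Q_eq elt_def Zero_in_word_set state_word_in_word_set)

lemmas qmul_zero_S_net [simp] = qmul_zero[OF subsetD[OF S_net_subset_Q]]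

lemma semigroup_on_S_net: "semigroup_on (S_net \<Gamma>) (qmul \<Gamma>)"
proof
  interpret Q: semigroup_on "Q \<Gamma>" "qmul \<Gamma>" by (rule semigroup_on_Q)
  fix x y z
  assume x: "x \<in> S_net \<Gamma>" and y: "y \<in> S_net \<Gamma>"
  show "qmul \<Gamma> (qmul \<Gamma> x y) z = qmul \<Gamma> x (qmul \<Gamma> y z)" if "z \<in> S_net \<Gamma>"
    using Q.assoc x y that S_net_subset_Q by blast
  show "qmul \<Gamma> x y \<in> S_net \<Gamma>"
  proof (cases "x = zero \<Gamma> \<or> y = zero \<Gamma>")
    case True
    then show ?thesis using x y zero_in_S_net by auto
  next
    case False
    then obtain C s D s' where "x = elt \<Gamma> s" "std \<Gamma> C s" "y = elt \<Gamma> s'" "std \<Gamma> D s'"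
      using x y unfolding S_net_eq by blast
    then show ?thesis
      using qmul_elt[of \<Gamma> C s D s'] elt_in_S_net zero_in_S_net
      by (cases "acts \<Gamma> (state_word s) s'") (auto simp: elt_def)
  qed
qed

abbreviation (input) idems where
  "idems \<equiv> idempotents (S_net \<Gamma>) (qmul \<Gamma>)"

lemma std_diagonal: "std \<Gamma> D (A, es, fs) \<Longrightarrow> std \<Gamma> D (D, fs, fs)"
  by (auto simp: std.simps)

lemma elt_right_identity:
  assumes "std \<Gamma> D (A, es, fs)"
  shows "qmul \<Gamma> (elt \<Gamma> (A, es, fs)) (elt \<Gamma> (D, fs, fs)) = elt \<Gamma> (A, es, fs)"
  using elt_mult_extend[OF assms, of D "[]" fs] std_diagonal[OF assms] by simp

lemma diagonal_idempotent:
  assumes "std \<Gamma> D (D, fs, fs)"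
  shows "elt \<Gamma> (D, fs, fs) \<in> idems"
  using elt_right_identity[OF assms] elt_in_S_net[OF assms] by (simp add: idempotents_def)

lemma zero_idempotent: "zero \<Gamma> \<in> idems"
  using zero_in_S_net by (simp add: idempotents_def)

text \<open>Squaring \<open>p q\<inverse>\<close> appends the part by which one of \<open>p\<close>, \<open>q\<close> exceeds the other to \<open>p\<close> or to
  \<open>q\<close>, so for an idempotent this part is empty and \<open>p = q\<close>.\<close>

lemma idempotent_cases:
  assumes "e \<in> idems"
  obtains "e = zero \<Gamma>"
  | D fs where "e = elt \<Gamma> (D, fs, fs)" "std \<Gamma> D (D, fs, fs)"
proof -
  have e: "e \<in> S_net \<Gamma>" "qmul \<Gamma> e e = e" using assms by (auto simp: idempotents_def)
  from e(1) show ?thesis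
  proof (cases rule: S_net_cases)
    case (2 D A es fs)
    show ?thesis
    proof (cases rule: mult_cases[of A D es fs])
      case 1
      then show ?thesis using elt_mult_zero[OF 2(2) 2(2)] e 2 elt_neq_zero that by metis
    next
      case (2 zs)
      then show ?thesis
        using elt_mult_extend[of \<Gamma> D A es fs D zs fs] \<open>std \<Gamma> D _\<close> \<open>e = elt _ _\<close> e(2)
          elt_inject[of D "(A, es @ zs, fs)" D "(A, es, fs)"] that(2) by auto
    next
      case (3 zs)
      then show ?thesis
        using elt_mult_absorb[of \<Gamma> D A es es zs D fs] \<open>std \<Gamma> D _\<close> \<open>e = elt _ _\<close> e(2)
          elt_inject[of D "(A, es, fs @ zs)" D "(A, es, fs)"] that(2) by auto
    qed
  qed (use that in auto)
qed

lemma idempotents_commute: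
  assumes "e \<in> idems" "f \<in> idems"
  shows "qmul \<Gamma> e f = qmul \<Gamma> f e"
proof (cases "e = zero \<Gamma> \<or> f = zero \<Gamma>")
  case True
  then show ?thesis using assms by (auto simp: idempotents_def)
next
  case False
  obtain C fs where e: "e = elt \<Gamma> (C, fs, fs)" "std \<Gamma> C (C, fs, fs)"
    using assms(1) False by (cases rule: idempotent_cases) blast+
  obtain D gs where f: "f = elt \<Gamma> (D, gs, gs)" "std \<Gamma> D (D, gs, gs)"
    using assms(2) False by (cases rule: idempotent_cases) blast+
  show ?thesis
  proof (cases rule: mult_cases[of D C gs fs])
    case 1
    then show ?thesis
      using elt_mult_zero[OF e(2) f(2)] elt_mult_zero[OF f(2) e(2)] e f by auto
  next
    case (2 zs)
    then show ?thesis
      using elt_mult_extend[of \<Gamma> C C fs fs C zs gs] elt_mult_absorb[of \<Gamma> C C gs fs zs C fs] e f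
      by auto
  next
    case (3 zs)
    then show ?thesis
      using elt_mult_extend[of \<Gamma> C C gs gs C zs fs] elt_mult_absorb[of \<Gamma> C C fs gs zs C gs] e f
      by auto
  qed
qed

text \<open>Whether \<open>(p q\<inverse>) x\<close> vanishes, and which walk is put behind \<open>p\<close>, depends only on \<open>q\<close> and
  \<open>x\<close>. Hence \<open>q q\<inverse>\<close> in place of \<open>p q\<inverse>\<close> changes nothing but the prefix.\<close>

lemma elt_mult_parallel:
  assumes "std \<Gamma> D (A, es, fs)" "x \<in> S_net \<Gamma>"
  obtains "qmul \<Gamma> (elt \<Gamma> (A, es, fs)) x = zero \<Gamma>" "qmul \<Gamma> (elt \<Gamma> (D, fs, fs)) x = zero \<Gamma>"
  | E zs hs where "qmul \<Gamma> (elt \<Gamma> (A, es, fs)) x = elt \<Gamma> (A, es @ zs, hs)"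
    "qmul \<Gamma> (elt \<Gamma> (D, fs, fs)) x = elt \<Gamma> (D, fs @ zs, hs)"
    "std \<Gamma> E (A, es @ zs, hs)" "std \<Gamma> E (D, fs @ zs, hs)"
  using assms(2)
proof (cases rule: S_net_cases)
  case 1
  then show ?thesis
    using that(1) elt_in_S_net[OF assms(1)] elt_in_S_net[OF std_diagonal[OF assms(1)]] by simp
next
  case (2 E C gs hs)
  note x = 2
  note d = std_diagonal[OF assms(1)]
  show ?thesis
  proof (cases rule: mult_cases[of C D gs fs])
    case 1
    then show ?thesis
      using that(1) x elt_mult_zero[OF assms(1) x(2)] elt_mult_zero[OF d x(2)] by simp
  next
    case (2 zs)
    then show ?thesis
      using that(2)[of zs hs E] x elt_mult_extend[OF assms(1), of E zs hs]
        elt_mult_extend[OF d, of E zs hs] by simp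
  next
    case (3 zs)
    then show ?thesis
      using that(2)[of "[]" "hs @ zs" E] x elt_mult_absorb[of \<Gamma> D A es gs zs E hs]
        elt_mult_absorb[of \<Gamma> D D fs gs zs E hs] assms(1) d by simp
  qed
qed

text \<open>A non-zero product \<open>(p q\<inverse>) x = p z k\<inverse>\<close> determines \<open>p z\<close> and \<open>k\<close> by uniqueness of normal
  forms, and then \<open>z\<close> by cancelling the list \<open>p\<close>; so it determines \<open>(q q\<inverse>) x = q z k\<inverse>\<close>.\<close>

lemma Lstar_elt:
  assumes "std \<Gamma> D (A, es, fs)"
  shows "Lstar (S_net \<Gamma>) (qmul \<Gamma>) (elt \<Gamma> (A, es, fs)) (elt \<Gamma> (D, fs, fs))"
proof (rule Lstar_idempotentI[OF semigroup_on_S_net])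
  let ?a = "elt \<Gamma> (A, es, fs)" and ?e = "elt \<Gamma> (D, fs, fs)"
  fix x y
  assume xy: "x \<in> S_net \<Gamma>" "y \<in> S_net \<Gamma>" and eq: "qmul \<Gamma> ?a x = qmul \<Gamma> ?a y"
  show "qmul \<Gamma> ?e x = qmul \<Gamma> ?e y"
  proof (cases rule: elt_mult_parallel[OF assms xy(1)])
    case x: 1
    show ?thesis
    proof (cases rule: elt_mult_parallel[OF assms xy(2)])
      case 1
      then show ?thesis using x by simp
    next
      case (2 E zs hs)
      then show ?thesis using x eq elt_neq_zero[OF 2(3)] by simp
    qed
  next
    case x: (2 E zs hs)
    show ?thesis
    proof (cases rule: elt_mult_parallel[OF assms xy(2)])
      case 1
      then show ?thesis using x eq elt_neq_zero[OF x(3)] by simp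
    next
      case (2 E' zs' hs')
      have "elt \<Gamma> (A, es @ zs, hs) = elt \<Gamma> (A, es @ zs', hs')"
        using eq x(1) 2(1) by simp
      then have "zs = zs'" "hs = hs'" using elt_inject[OF x(3) 2(3)] by blast+
      then show ?thesis using x(2) 2(2) by simp
    qed
  qed
qed (fact elt_in_S_net[OF assms] diagonal_idempotent[OF std_diagonal[OF assms]]
    elt_right_identity[OF assms])+

lemma Lstar_zero: "Lstar (S_net \<Gamma>) (qmul \<Gamma>) (zero \<Gamma>) (zero \<Gamma>)"
  by (simp add: Lstar_def)

lemmas star_S_net_eqI = star_eqI[OF semigroup_on_S_net idempotents_commute]

lemma star_elt:
  assumes "std \<Gamma> D (A, es, fs)"
  shows "star (S_net \<Gamma>) (qmul \<Gamma>) (elt \<Gamma> (A, es, fs)) = elt \<Gamma> (D, fs, fs)"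
  using Lstar_elt[OF assms] diagonal_idempotent[OF std_diagonal[OF assms]]
  by (intro star_S_net_eqI)

lemma star_zero: "star (S_net \<Gamma>) (qmul \<Gamma>) (zero \<Gamma>) = zero \<Gamma>"
  by (intro star_S_net_eqI Lstar_zero zero_idempotent)

text \<open>Write \<open>e = g g\<inverse>\<close> and \<open>a = p q\<inverse>\<close>. If \<open>p\<close> extends \<open>g\<close>, then \<open>e a = a\<close>. If \<open>g = p z\<close>, then
  \<open>e a = g (q z)\<inverse>\<close>, whose idempotent \<open>(q z)(q z)\<inverse>\<close> multiplies \<open>a\<close> from the right to
  \<open>p z (q z)\<inverse>\<close>, the same element. In all other cases \<open>e a = 0\<close>.\<close>

lemma ample_identity:
  assumes "a \<in> S_net \<Gamma>" "e \<in> idems"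
  shows "qmul \<Gamma> e a = qmul \<Gamma> a (star (S_net \<Gamma>) (qmul \<Gamma>) (qmul \<Gamma> e a))"
proof (cases "a = zero \<Gamma> \<or> e = zero \<Gamma>")
  case True
  then show ?thesis
    using assms star_zero zero_in_S_net by (auto simp: idempotents_def)
next
  case False
  obtain D A es fs where a: "a = elt \<Gamma> (A, es, fs)" "std \<Gamma> D (A, es, fs)"
    using assms(1) False by (cases rule: S_net_cases) blast+
  obtain C gs where e: "e = elt \<Gamma> (C, gs, gs)" "std \<Gamma> C (C, gs, gs)"
    using assms(2) False by (cases rule: idempotent_cases) blast+
  show ?thesis
  proof (cases rule: mult_cases[of A C es gs])
    case 1
    then have "qmul \<Gamma> e a = zero \<Gamma>" using elt_mult_zero[OF e(2) a(2)] a e by simp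
    then show ?thesis using star_zero assms(1) by simp
  next
    case (2 zs)
    then have "qmul \<Gamma> e a = a"
      using elt_mult_extend[OF e(2), of D zs fs] a e by simp
    then show ?thesis using a star_elt elt_right_identity by simp
  next
    case (3 zs)
    then have ea: "qmul \<Gamma> e a = elt \<Gamma> (C, gs, fs @ zs)" "std \<Gamma> D (C, gs, fs @ zs)"
      using elt_mult_absorb[of \<Gamma> C C gs es zs D fs] a e by simp_all
    have "qmul \<Gamma> a (elt \<Gamma> (D, fs @ zs, fs @ zs)) = elt \<Gamma> (A, es @ zs, fs @ zs)"
      using elt_mult_extend[OF a(2) std_diagonal[OF ea(2)]] a by simp
    then show ?thesis using ea star_elt 3 by simp
  qed
qed

end

theorem proposition3p15:
  fixes \<Gamma> :: "('v, 't) net"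
  assumes "network \<Gamma>"
  shows "right_ample (S_net \<Gamma>) (qmul \<Gamma>) \<and> (\<exists>z. is_zero (S_net \<Gamma>) (qmul \<Gamma>) z)"
proof -
  interpret network \<Gamma> by fact
  interpret semigroup_on "S_net \<Gamma>" "qmul \<Gamma>" by (rule semigroup_on_S_net)
  have "right_ample (S_net \<Gamma>) (qmul \<Gamma>)"
  proof
    show "\<exists>e\<in>idems. Lstar (S_net \<Gamma>) (qmul \<Gamma>) a e" if "a \<in> S_net \<Gamma>" for a
      using that
      by (cases rule: S_net_cases)
        (blast intro: Lstar_zero zero_idempotent Lstar_elt diagonal_idempotent std_diagonal)+
  qed (fact idempotents_commute, fact ample_identity)
  moreover have "is_zero (S_net \<Gamma>) (qmul \<Gamma>) (zero \<Gamma>)"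
    using zero_in_S_net by (simp add: is_zero_def)
  ultimately show ?thesis by blast
qed

end
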